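(* Let $A$ be an AW*-algebra of type $\mathrm{I}_n$ with $n\geq 3$, and let $p\in\mathbb{C}[x]$ be a nonconstant polynomial. Then every element of $A$ can be written as a product of two elements of $p[A,A]=\{p(ab)-p(ba)\mid a,b\in A\}$.
   Context: AW*-algebras of type $\mathrm{I}_n$ are as in Berberian's "Baer *-rings" (Definition 18.2); equivalently, such an algebra is *-isomorphic to $\mathrm{M}_n(C(X))$, where $X$ is an extremally disconnected compact Hausdorff space (the closure of every open set is open) and $C(X)$ is the algebra of continuous complex-valued functions on $X$. *)

theory Defs
  imports "HOL-Analysis.Analysis" "HOL-Computational_Algebra.Polynomial"
begin

definition extremally_disconnected :: "'x::topological_space itself \<Rightarrow> bool" where
  "extremally_disconnected _ \<longleftrightarrow> (\<forall>U::'x set. open U \<longrightarrow> open (closure U))"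

text \<open>The algebra M_n(C(X)): n x n matrices whose entries are continuous complex-valued
  functions on X, represented (via the canonical identification) as functions
  X \<Rightarrow> complex^n^n with every entry continuous. Algebra operations are pointwise
  (matrix product at each point).\<close>
definition MnCX :: "('x::topological_space \<Rightarrow> complex^'n^'n) set" where
  "MnCX = {A. \<forall>i j. continuous_on UNIV (\<lambda>x. A x $ i $ j)}"

definition MnCX_mult :: "('x \<Rightarrow> complex^'n^'n) \<Rightarrow> ('x \<Rightarrow> complex^'n^'n) \<Rightarrow> ('x \<Rightarrow> complex^'n^'n)" where
  "MnCX_mult A B = (\<lambda>x. A x ** B x)"

primrec matpow :: "complex^'n^'n \<Rightarrow> nat \<Rightarrow> complex^'n^'n" where
  "matpow M 0 = mat 1"
| "matpow M (Suc k) = M ** matpow M k"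

definition mat_poly :: "complex poly \<Rightarrow> complex^'n^'n \<Rightarrow> complex^'n^'n" where
  "mat_poly p M = (\<Sum>i\<le>degree p. mat (coeff p i) ** matpow M i)"

definition MnCX_poly :: "complex poly \<Rightarrow> ('x \<Rightarrow> complex^'n^'n) \<Rightarrow> ('x \<Rightarrow> complex^'n^'n)" where
  "MnCX_poly p A = (\<lambda>x. mat_poly p (A x))"

definition poly_commutators :: "complex poly \<Rightarrow> ('x::topological_space \<Rightarrow> complex^'n^'n) set" where
  "poly_commutators p = {MnCX_poly p (MnCX_mult a b) - MnCX_poly p (MnCX_mult b a) | a b. a \<in> MnCX \<and> b \<in> MnCX}"

end

theory Submission
  imports Defs "HOL-Computational_Algebra.Fundamental_Theorem_Algebra"
begin

text \<open>A compact relation between an extremally disconnected space \<open>X\<close> and a Hausdorff space that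
  projects onto \<open>X\<close> has a continuous section (Gleason): a minimal compact subrelation projecting
  onto \<open>X\<close> is the graph of a function. Every complex matrix is unitarily equivalent to one with
  constant diagonal, as a minimizer of the sum of squared diagonal moduli over the unitary group
  shows; since that group is compact, the unitary can be chosen continuously in the point of \<open>X\<close>.

  Consequently every \<open>v\<close> of trace zero is \<open>p(ab) - p(ba)\<close>: one may assume that \<open>v\<close> has zero diagonal,
  and then \<open>v = (E + N) - (E + L)\<close> with \<open>N\<close> strictly upper triangular, \<open>L\<close> strictly lower triangular
  and \<open>E = p(D)\<close> for a constant diagonal matrix \<open>D\<close> such that \<open>E\<close> has distinct diagonal entries. Both
  summands are continuously similar to \<open>E\<close>, say \<open>E + N = g E g\<inverse>\<close> and \<open>E + L = h E h\<inverse>\<close>, and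
  \<open>a = g D h\<inverse>\<close>, \<open>b = h g\<inverse>\<close> do the job.

  Finally, if \<open>c\<close> has constant diagonal and \<open>w\<close> is the diagonal matrix of the \<open>n\<close>-th roots of unity,
  then \<open>c = w\<inverse> (w c)\<close> and both factors have trace zero.\<close>

subsection \<open>Continuous sections over extremally disconnected spaces\<close>

text \<open>In a minimal compact subrelation no point has two values: disjoint neighbourhoods of
  them would give disjoint open subsets of the base, whose closures are still disjoint by extremal
  disconnectedness, although both contain the point.\<close>

lemma continuous_section_of_compact_relation:
  fixes K :: "('x::t2_space \<times> 'y::t2_space) set"
  assumes ed: "extremally_disconnected TYPE('x)"
    and K: "compact K" and onto: "fst ` K = UNIV"
  shows "\<exists>s. continuous_on UNIV s \<and> (\<forall>x. (x, s x) \<in> K)"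
proof -
  \<comment> \<open>Zorn's lemma is applied to the open sets that can be removed from
    \<open>K\<close> without emptying a fibre.\<close>
  define \<A> where "\<A> = {V. open V \<and> fst ` (K - V) = UNIV}"
  have "\<Union>\<C> \<in> \<A>" if ne: "\<C> \<noteq> {}" and ch: "subset.chain \<A> \<C>" for \<C>
  proof -
    have sub: "\<C> \<subseteq> \<A>"
      using ch unfolding subset_chain_def by blast
    \<comment> \<open>Fibres are compact: if the union of the chain contained one, finitely many
      members would cover it, and the largest of these would already empty it.\<close>
    have "x \<in> fst ` (K - \<Union>\<C>)" for x
    proof (rule ccontr)
      assume nx: "x \<notin> fst ` (K - \<Union>\<C>)"
      have cover: "K \<inter> ({x} \<times> UNIV) \<subseteq> \<Union>\<C>"
      proof
        fix z assume z: "z \<in> K \<inter> ({x} \<times> UNIV)"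
        show "z \<in> \<Union>\<C>"
        proof (rule ccontr)
          assume "z \<notin> \<Union>\<C>"
          with z have "fst z \<in> fst ` (K - \<Union>\<C>)"
            by (intro imageI DiffI) simp
          with z nx show False
            by (simp add: mem_Times_iff)
        qed
      qed
      have "closed ({x} \<times> (UNIV :: 'y set))"
        by (intro closed_Times) auto
      then have "compact (K \<inter> ({x} \<times> UNIV))"
        using K by (rule compact_Int_closed[rotated])
      moreover have "open V" if "V \<in> \<C>" for V
        using that sub by (auto simp: \<A>_def)
      ultimately obtain \<F> where \<F>: "\<F> \<subseteq> \<C>" "finite \<F>" "K \<inter> ({x} \<times> UNIV) \<subseteq> \<Union>\<F>"
        using cover by (meson compactE)
      obtain V where V: "V \<in> \<C>" "\<Union>\<F> \<subseteq> V"
      proof (cases "\<F> = {}")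
        case True
        then show ?thesis using ne that by auto
      next
        case False
        have "subset.chain \<A> \<F>"
          using ch \<F>(1) by (meson subset_chain_def subset_iff)
        then have "\<Union>\<F> \<in> \<F>"
          by (rule Union_in_chain[OF \<F>(2) False])
        then show ?thesis using \<F>(1) that by auto
      qed
      then have "x \<in> fst ` (K - V)"
        using sub by (auto simp: \<A>_def)
      then obtain y where "(x, y) \<in> K - V"
        unfolding fst_eq_Domain by (rule DomainE)
      moreover from this have "(x, y) \<in> V"
        using \<F>(3) V(2) by blast
      ultimately show False
        by blast
    qed
    moreover have "open (\<Union>\<C>)"
      using sub by (auto simp: \<A>_def)
    ultimately show ?thesis
      by (auto simp: \<A>_def)
  qed
  moreover have "{} \<in> \<A>"
    using onto by (simp add: \<A>_def)
  ultimately obtain V where V: "V \<in> \<A>" and max: "\<And>W. W \<in> \<A> \<Longrightarrow> V \<subseteq> W \<Longrightarrow> W = V"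
    using subset_Zorn_nonempty[of \<A>] by blast
  define E where "E = K - V"
  have oV: "open V" and E_onto: "fst ` E = UNIV"
    using V by (auto simp: \<A>_def E_def)
  have cE: "compact E"
    unfolding E_def using K oV by (rule compact_diff)
  \<comment> \<open>Here \<open>E - G = K - (V \<union> G)\<close>, so maximality of
    \<open>V\<close> forbids any further removal.\<close>
  have minimal: "E \<inter> G = {}" if "open G" "fst ` (E - G) = UNIV" for G
  proof -
    have "V \<union> G \<in> \<A>"
      using that oV by (auto simp: \<A>_def E_def Diff_Un Diff_Diff_Int set_diff_eq)
    then have "V \<union> G = V"
      using max by blast
    then show ?thesis
      by (auto simp: E_def)
  qed
  \<comment> \<open>The points whose whole fibre in \<open>E\<close> lies in \<open>G\<close>; the
    complement is a compact image, hence closed.\<close>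
  define saturated where "saturated G = - fst ` (E - G)" for G
  have open_saturated: "open (saturated G)" if "open G" for G
  proof -
    have "compact (fst ` (E - G))"
      using compact_diff[OF cE that] by (intro compact_continuous_image continuous_on_fst continuous_on_id)
    then show ?thesis
      by (simp add: saturated_def compact_imp_closed open_Compl)
  qed
  have dense: "x \<in> closure (saturated G)" if G: "open G" and xy: "(x, y) \<in> E \<inter> G" for x y G
  proof -
    have "saturated G \<inter> N \<noteq> {}" if N: "open N" "x \<in> N" for N
    proof -
      \<comment> \<open>Minimality is applied to the part of \<open>G\<close> over \<open>N\<close>:
        removing it empties some fibre, which therefore lies over \<open>N\<close> and inside
        \<open>G\<close>.\<close>
      define G' where "G' = G \<inter> (N \<times> UNIV)"
      have "open G'"
        unfolding G'_def using G N by (intro open_Int open_Times) auto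
      moreover have "E \<inter> G' \<noteq> {}"
        using xy N by (auto simp: G'_def)
      ultimately obtain x' where x': "x' \<notin> fst ` (E - G')"
        using minimal by blast
      obtain y' where "(x', y') \<in> E"
        using E_onto unfolding fst_eq_Domain by blast
      with x' have "x' \<in> N"
        by (force simp: G'_def)
      moreover have "x' \<in> saturated G"
        using x' by (auto simp: saturated_def G'_def image_iff)
      ultimately show ?thesis by blast
    qed
    then show ?thesis
      using closure_iff_nhds_not_empty by blast
  qed
  have inj: "y1 = y2" if "(x, y1) \<in> E" "(x, y2) \<in> E" for x y1 y2
  proof (rule ccontr)
    assume "y1 \<noteq> y2"
    then obtain V1 V2 where V12: "open V1" "open V2" "y1 \<in> V1" "y2 \<in> V2" "V1 \<inter> V2 = {}"
      by (meson hausdorff)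
    define G1 where "G1 = (UNIV :: 'x set) \<times> V1"
    define G2 where "G2 = (UNIV :: 'x set) \<times> V2"
    have o: "open G1" "open G2"
      using V12 by (auto simp: G1_def G2_def intro: open_Times)
    have "saturated G1 \<inter> saturated G2 = {}"
    proof (rule ccontr)
      assume "saturated G1 \<inter> saturated G2 \<noteq> {}"
      then obtain x' where x': "x' \<in> saturated G1" "x' \<in> saturated G2" by blast
      obtain y' where "(x', y') \<in> E"
        using E_onto unfolding fst_eq_Domain by blast
      then have "y' \<in> V1 \<inter> V2"
        using x' by (force simp: saturated_def G1_def G2_def)
      then show False using V12 by simp
    qed
    \<comment> \<open>An open set disjoint from another set misses its closure. This is used first
      for \<open>saturated G2\<close>, then for \<open>closure (saturated G1)\<close>, which is
      itself open.\<close>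
    then have "closure (saturated G1) \<inter> saturated G2 = {}"
      using open_saturated[OF o(2)] open_Int_closure_eq_empty[of "saturated G2" "saturated G1"] by (simp add: Int_commute)
    moreover have "open (closure (saturated G1))"
      using ed open_saturated[OF o(1)] by (simp add: extremally_disconnected_def)
    ultimately have "closure (saturated G1) \<inter> closure (saturated G2) = {}"
      using open_Int_closure_eq_empty by blast
    moreover have "x \<in> closure (saturated G1)" "x \<in> closure (saturated G2)"
      using dense[OF o(1)] dense[OF o(2)] that V12 by (auto simp: G1_def G2_def)
    ultimately show False by blast
  qed
  \<comment> \<open>\<open>t\<close> inverts the projection restricted to \<open>E\<close>, a
    continuous injection from a compact space to a Hausdorff one, and so is continuous.\<close>
  define t where "t x = (THE z. z \<in> E \<and> fst z = x)" for x
  have t: "t (fst z) = z" if "z \<in> E" for z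
    unfolding t_def
  proof (rule the_equality)
    fix z' assume z': "z' \<in> E \<and> fst z' = fst z"
    then have "snd z' = snd z"
      using that inj[of "fst z" "snd z'" "snd z"] by (cases z, cases z') auto
    with z' show "z' = z"
      by (simp add: prod_eq_iff)
  qed (use that in auto)
  have "continuous_on (fst ` E) t"
    using cE t by (intro continuous_on_inv) (auto intro: continuous_on_fst continuous_on_id)
  then have ct: "continuous_on UNIV (\<lambda>x. snd (t x))"
    unfolding E_onto by (rule continuous_on_snd)
  have "(x, snd (t x)) \<in> K" for x
  proof -
    obtain z where "z \<in> E" "x = fst z"
      using E_onto by blast
    then show ?thesis
      using t[of z] by (simp add: E_def)
  qed
  with ct show ?thesis by blast
qed

subsection \<open>Unitary equivalence to a constant diagonal\<close>

definition cadj :: "complex^'n^'n \<Rightarrow> complex^'n^'n" where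
  "cadj A = (\<chi> i j. cnj (A $ j $ i))"

definition unitaries :: "(complex^'n^'n) set" where
  "unitaries = {U. cadj U ** U = mat 1}"

lemma continuous_on_matrix_mult [continuous_intros]:
  fixes f g :: "'a::topological_space \<Rightarrow> complex^'n^'n"
  assumes "continuous_on S f" "continuous_on S g"
  shows "continuous_on S (\<lambda>x. f x ** g x)"
  unfolding matrix_matrix_mult_def
  by (intro continuous_intros assms)

lemma continuous_on_cadj [continuous_intros]:
  assumes "continuous_on S f"
  shows "continuous_on S (\<lambda>x. cadj (f x))"
  unfolding cadj_def by (intro continuous_intros assms)

lemma cadj_mult: "cadj (A ** B) = cadj B ** cadj A"
  by (simp add: cadj_def matrix_matrix_mult_def vec_eq_iff mult.commute)

lemma unitaries_mult: "U \<in> unitaries \<Longrightarrow> W \<in> unitaries \<Longrightarrow> U ** W \<in> unitaries"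
  unfolding unitaries_def mem_Collect_eq cadj_mult
  by (metis matrix_mul_assoc matrix_mul_lid)

lemma unitary_entry_le_1:
  assumes "U \<in> unitaries"
  shows "norm (U $ i $ j) \<le> 1"
proof -
  have "(cadj U ** U) $ j $ j = 1"
    using assms by (simp add: unitaries_def mat_def)
  then have "(\<Sum>k\<in>UNIV. complex_of_real ((norm (U $ k $ j))\<^sup>2)) = 1"
    unfolding complex_norm_square by (simp add: cadj_def matrix_matrix_mult_def mult.commute)
  then have "(\<Sum>k\<in>UNIV. (norm (U $ k $ j))\<^sup>2) = 1"
    unfolding of_real_sum[symmetric] by (metis of_real_eq_1_iff)
  moreover have "(norm (U $ i $ j))\<^sup>2 \<le> (\<Sum>k\<in>UNIV. (norm (U $ k $ j))\<^sup>2)"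
    by (intro member_le_sum) auto
  ultimately show ?thesis
    by (simp add: power_le_one_iff)
qed

lemma compact_unitaries: "compact (unitaries :: (complex^'n::finite^'n) set)"
proof -
  have "norm U \<le> (\<Sum>i\<in>(UNIV :: 'n set). \<Sum>j\<in>(UNIV :: 'n set). 1)"
    if "U \<in> unitaries" for U :: "complex^'n^'n"
  proof -
    have "norm U \<le> (\<Sum>i\<in>UNIV. norm (U $ i))"
      by (simp add: norm_vec_def L2_set_le_sum)
    also have "\<dots> \<le> (\<Sum>i\<in>UNIV. \<Sum>j\<in>UNIV. norm (U $ i $ j))"
      by (intro sum_mono) (simp add: norm_vec_def L2_set_le_sum)
    also have "\<dots> \<le> (\<Sum>i\<in>(UNIV :: 'n set). \<Sum>j\<in>(UNIV :: 'n set). 1)"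
      by (intro sum_mono unitary_entry_le_1 that)
    finally show ?thesis .
  qed
  then have "bounded (unitaries :: (complex^'n^'n) set)"
    unfolding bounded_iff by blast
  moreover have "closed (unitaries :: (complex^'n^'n) set)"
    unfolding unitaries_def
    by (intro closed_Collect_eq continuous_intros)
  ultimately show ?thesis
    by (simp add: compact_eq_bounded_closed)
qed

text \<open>For a 2 by 2 block with diagonal \<open>m + a\<close>, \<open>m - a\<close> and
  off-diagonal entries \<open>b\<close>, \<open>c\<close>, the left side is the deviation of the
  rotated diagonal entries from their mean \<open>m\<close>; its vanishing makes them equal.\<close>

lemma equalizing_rotation:
  fixes a b c :: complex
  shows "\<exists>s t w. s\<^sup>2 + t\<^sup>2 = (1::real) \<and> norm w = 1 \<and>
    a * (of_real s ^ 2 - of_real t ^ 2) + of_real s * of_real t * (w * b + cnj w * c) = 0"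
proof (cases "a = 0")
  case True
  then show ?thesis
    by (intro exI[of _ 1] exI[of _ 0]) auto
next
  case False
  \<comment> \<open>The phase \<open>w\<close> is to make \<open>w * b + cnj w * c\<close> a real
    multiple of \<open>a\<close>, so that a real equation remains. Half a turn negates
    \<open>h\<close>, which therefore has a zero.\<close>
  define h where "h \<phi> = Im (cis \<phi> * (b / a) + cnj (cis \<phi>) * (c / a))" for \<phi>
  have h: "continuous_on {0..pi} h"
    unfolding h_def cis_conv_exp by (intro continuous_intros)
  have "h pi = - h 0"
    by (simp add: h_def)
  then have "\<exists>\<phi>. h \<phi> = 0"
    using IVT'[of h 0 0 pi, OF _ _ _ h] IVT2'[of h pi 0 0, OF _ _ _ h] by (cases "h 0 \<le> 0") auto
  then obtain \<phi> where \<phi>: "h \<phi> = 0" ..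
  define w where "w = cis \<phi>"
  define r where "r = Re (w * (b / a) + cnj w * (c / a))"
  have "of_real r = w * (b / a) + cnj w * (c / a)"
    using \<phi> by (simp add: complex_eq_iff r_def h_def w_def)
  then have r: "w * b + cnj w * c = a * of_real r"
    using False by (simp add: field_simps)
  \<comment> \<open>\<open>g\<close> is 1 at 0 and -1 at \<open>pi/2\<close>, so it vanishes in
    between.\<close>
  define g where "g \<theta> = (cos \<theta>)\<^sup>2 - (sin \<theta>)\<^sup>2 + cos \<theta> * sin \<theta> * r" for \<theta>
  have "\<exists>\<theta>. 0 \<le> \<theta> \<and> \<theta> \<le> pi/2 \<and> g \<theta> = 0"
    by (rule IVT2') (auto simp: g_def intro!: continuous_intros)
  then obtain \<theta> where "g \<theta> = 0" by blast
  then have "a * of_real (g \<theta>) = 0" by simp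
  then have "a * (of_real (cos \<theta>) ^ 2 - of_real (sin \<theta>) ^ 2) +
      of_real (cos \<theta>) * of_real (sin \<theta>) * (w * b + cnj w * c) = 0"
    unfolding r g_def by (simp add: algebra_simps)
  then show ?thesis
    by (intro exI[of _ "cos \<theta>"] exI[of _ "sin \<theta>"] exI[of _ w]) (simp add: w_def)
qed

text \<open>For \<open>i \<noteq> j\<close> and squared moduli of \<open>s\<close> and
  \<open>z\<close> summing to 1, this is an element of SU(2) in the plane of the coordinates
  \<open>i\<close> and \<open>j\<close>, with columns \<open>(s, z)\<close> and
  \<open>(- cnj z, cnj s)\<close>.\<close>

definition rotation :: "'n \<Rightarrow> 'n \<Rightarrow> complex \<Rightarrow> complex \<Rightarrow> complex^'n^'n" where
  "rotation i j s z = (\<chi> k l.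
     if l = i then (if k = i then s else if k = j then z else 0)
     else if l = j then (if k = i then - cnj z else if k = j then cnj s else 0)
     else if k = l then 1 else 0)"

lemma sum_UNIV_pair:
  fixes f :: "'n::finite \<Rightarrow> 'a::comm_monoid_add"
  assumes "i \<noteq> j" "\<And>k. k \<noteq> i \<Longrightarrow> k \<noteq> j \<Longrightarrow> f k = 0"
  shows "(\<Sum>k\<in>UNIV. f k) = f i + f j"
proof -
  have "(\<Sum>k\<in>UNIV. f k) = (\<Sum>k\<in>{i, j}. f k)"
    using assms(2) by (intro sum.mono_neutral_right) auto
  then show ?thesis using assms(1) by simp
qed

lemma sum_UNIV_single:
  fixes f :: "'n::finite \<Rightarrow> 'a::comm_monoid_add"
  assumes "\<And>k. k \<noteq> i \<Longrightarrow> f k = 0"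
  shows "(\<Sum>k\<in>UNIV. f k) = f i"
proof -
  have "(\<Sum>k\<in>UNIV. f k) = (\<Sum>k\<in>{i}. f k)"
    using assms by (intro sum.mono_neutral_right) auto
  then show ?thesis by simp
qed

lemma rotation_unitary:
  assumes "i \<noteq> j" "cnj s * s + cnj z * z = 1"
  shows "rotation i j s z \<in> (unitaries :: (complex^'n::finite^'n) set)"
proof -
  let ?J = "rotation i j s z :: complex^'n^'n"
  have "(\<Sum>m\<in>UNIV. cnj (?J $ m $ k) * ?J $ m $ l) = (if k = l then 1 else 0)" for k l
  proof (cases "k = i \<or> k = j")
    case True
    then have "(\<Sum>m\<in>UNIV. cnj (?J $ m $ k) * ?J $ m $ l) =
        cnj (?J $ i $ k) * ?J $ i $ l + cnj (?J $ j $ k) * ?J $ j $ l"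
      using assms(1) by (intro sum_UNIV_pair) (auto simp: rotation_def)
    then show ?thesis
      using True assms by (auto simp: rotation_def algebra_simps)
  next
    case False
    then have "(\<Sum>m\<in>UNIV. cnj (?J $ m $ k) * ?J $ m $ l) = cnj (?J $ k $ k) * ?J $ k $ l"
      by (intro sum_UNIV_single) (auto simp: rotation_def)
    then show ?thesis
      using False assms by (auto simp: rotation_def)
  qed
  then show ?thesis
    by (simp add: unitaries_def cadj_def matrix_matrix_mult_def mat_def vec_eq_iff)
qed

lemma rotation_conj_diag:
  fixes M :: "complex^'n::finite^'n"
  assumes "i \<noteq> j"
  shows "(cadj (rotation i j s z) ** M ** rotation i j s z) $ k $ k =
    (if k = i then cnj s * M $ i $ i * s + cnj z * M $ j $ i * s + cnj s * M $ i $ j * z + cnj z * M $ j $ j * z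
     else if k = j then z * M $ i $ i * cnj z - s * M $ j $ i * cnj z - z * M $ i $ j * cnj s + s * M $ j $ j * cnj s
     else M $ k $ k)"
proof -
  let ?J = "rotation i j s z :: complex^'n^'n"
  have eq: "(cadj ?J ** M ** ?J) $ k $ k =
      (\<Sum>b\<in>UNIV. (\<Sum>a\<in>UNIV. cnj (?J $ a $ k) * M $ a $ b) * ?J $ b $ k)"
    by (simp add: cadj_def matrix_matrix_mult_def)
  show ?thesis
  proof (cases "k = i \<or> k = j")
    case True
    then have 1: "(\<Sum>a\<in>UNIV. cnj (?J $ a $ k) * M $ a $ b) =
        cnj (?J $ i $ k) * M $ i $ b + cnj (?J $ j $ k) * M $ j $ b" for b
      using assms(1) by (intro sum_UNIV_pair) (auto simp: rotation_def)
    have "(cadj ?J ** M ** ?J) $ k $ k =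
      (cnj (?J $ i $ k) * M $ i $ i + cnj (?J $ j $ k) * M $ j $ i) * ?J $ i $ k +
      (cnj (?J $ i $ k) * M $ i $ j + cnj (?J $ j $ k) * M $ j $ j) * ?J $ j $ k"
      unfolding eq 1 using True assms(1) by (intro sum_UNIV_pair) (auto simp: rotation_def)
    then show ?thesis
      using True assms by (auto simp: rotation_def algebra_simps)
  next
    case False
    then have 1: "(\<Sum>a\<in>UNIV. cnj (?J $ a $ k) * M $ a $ b) = cnj (?J $ k $ k) * M $ k $ b" for b
      by (intro sum_UNIV_single) (auto simp: rotation_def)
    have "(cadj ?J ** M ** ?J) $ k $ k = (cnj (?J $ k $ k) * M $ k $ k) * ?J $ k $ k"
      unfolding eq 1 using False by (intro sum_UNIV_single) (auto simp: rotation_def)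
    then show ?thesis
      using False by (simp add: rotation_def)
  qed
qed

text \<open>If a minimizer had distinct diagonal entries \<open>m + a\<close> and
  \<open>m - a\<close>, a rotation could replace both by \<open>m\<close> and keep the others; by
  the parallelogram law this lowers the sum of squares by twice the squared modulus of
  \<open>a\<close>.\<close>

lemma exists_unitary_constant_diagonal:
  fixes M :: "complex^'n::finite^'n"
  shows "\<exists>U\<in>unitaries. \<forall>i k. (cadj U ** M ** U) $ i $ i = (cadj U ** M ** U) $ k $ k"
proof -
  define f where "f U = (\<Sum>i\<in>UNIV. (norm ((cadj U ** M ** U) $ i $ i))\<^sup>2)" for U :: "complex^'n^'n"
  have "cadj (mat 1) = (mat 1 :: complex^'n^'n)"
    by (simp add: cadj_def mat_def vec_eq_iff)
  then have "mat 1 \<in> (unitaries :: (complex^'n^'n) set)"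
    by (simp add: unitaries_def)
  moreover have "continuous_on unitaries f"
    unfolding f_def by (intro continuous_intros)
  ultimately obtain U where U: "U \<in> unitaries" and min: "\<And>W. W \<in> unitaries \<Longrightarrow> f U \<le> f W"
    using continuous_attains_inf[OF compact_unitaries] by (metis empty_iff)
  define D where "D = cadj U ** M ** U"
  have "D $ i $ i = D $ k $ k" for i k
  proof (rule ccontr)
    assume neq: "D $ i $ i \<noteq> D $ k $ k"
    then have ik: "i \<noteq> k" by auto
    define m where "m = (D $ i $ i + D $ k $ k) / 2"
    define a where "a = (D $ i $ i - D $ k $ k) / 2"
    have Dii: "D $ i $ i = m + a" and Dkk: "D $ k $ k = m - a"
      by (simp_all add: m_def a_def field_simps)
    have "a \<noteq> 0"
      using neq by (simp add: a_def)
    obtain s t :: real and w :: complex where st: "s\<^sup>2 + t\<^sup>2 = 1" and w: "norm w = 1"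
      and eq: "a * (of_real s ^ 2 - of_real t ^ 2) +
        of_real s * of_real t * (w * D $ i $ k + cnj w * D $ k $ i) = 0"
      using equalizing_rotation by blast
    have ww: "w * cnj w = 1"
      using w by (simp flip: complex_norm_square)
    have st': "complex_of_real s ^ 2 + of_real t ^ 2 = 1"
      using st by (metis of_real_1 of_real_add of_real_power)
    define z where "z = of_real t * w"
    define J :: "complex^'n^'n" where "J = rotation i k (of_real s) z"
    have "cnj (of_real s) * of_real s + cnj z * z = complex_of_real s ^ 2 + of_real t ^ 2 * (w * cnj w)"
      by (simp add: z_def power2_eq_square)
    then have "J \<in> unitaries"
      unfolding J_def using ik st' ww by (intro rotation_unitary) simp_all
    then have UJ: "U ** J \<in> unitaries"
      using U by (rule unitaries_mult[rotated])
    have conj: "cadj (U ** J) ** M ** (U ** J) = cadj J ** D ** J"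
      by (simp add: cadj_mult D_def matrix_mul_assoc)
    have i: "(cadj J ** D ** J) $ i $ i = m"
    proof -
      have "(cadj J ** D ** J) $ i $ i = m * (of_real s ^ 2 + of_real t ^ 2 * (w * cnj w)) +
          a * (of_real s ^ 2 - of_real t ^ 2 * (w * cnj w)) +
          of_real s * of_real t * (w * D $ i $ k + cnj w * D $ k $ i)"
        unfolding J_def rotation_conj_diag[OF ik]
        by (simp add: z_def Dii Dkk algebra_simps power2_eq_square)
      then show ?thesis
        using eq by (simp add: ww st' add.assoc)
    qed
    have k: "(cadj J ** D ** J) $ k $ k = m"
    proof -
      have "(cadj J ** D ** J) $ k $ k = m * (of_real s ^ 2 + of_real t ^ 2 * (w * cnj w)) -
          (a * (of_real s ^ 2 - of_real t ^ 2 * (w * cnj w)) +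
          of_real s * of_real t * (w * D $ i $ k + cnj w * D $ k $ i))"
        unfolding J_def rotation_conj_diag[OF ik] using ik
        by (simp add: z_def Dii Dkk algebra_simps power2_eq_square)
      then show ?thesis
        using eq by (simp add: ww st')
    qed
    have other: "(cadj J ** D ** J) $ l $ l = D $ l $ l" if "l \<noteq> i" "l \<noteq> k" for l
      unfolding J_def rotation_conj_diag[OF ik] using that by simp
    have split: "(\<Sum>l\<in>UNIV. g l) = (\<Sum>l\<in>UNIV - {i, k}. g l) + (g i + g k)" for g :: "'n \<Rightarrow> real"
      using ik by (subst sum.subset_diff[of "{i, k}"]) auto
    have "f (U ** J) = (\<Sum>l\<in>UNIV - {i, k}. (norm (D $ l $ l))\<^sup>2) + ((norm m)\<^sup>2 + (norm m)\<^sup>2)"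
      unfolding f_def conj split by (simp add: i k other)
    moreover have "f U = (\<Sum>l\<in>UNIV - {i, k}. (norm (D $ l $ l))\<^sup>2) + ((norm (m + a))\<^sup>2 + (norm (m - a))\<^sup>2)"
      unfolding f_def split by (simp add: D_def[symmetric] Dii Dkk)
    moreover have "(norm (m + a))\<^sup>2 + (norm (m - a))\<^sup>2 = 2 * (norm m)\<^sup>2 + 2 * (norm a)\<^sup>2"
      by (simp only: cmod_power2) (simp add: power2_eq_square algebra_simps)
    ultimately have "f (U ** J) < f U"
      using \<open>a \<noteq> 0\<close> by simp
    with min[OF UJ] show False by simp
  qed
  with U show ?thesis
    unfolding D_def by blast
qed

subsection \<open>Diagonalization of triangular matrices\<close>

text \<open>If \<open>N\<close> is strictly upper triangular for the order induced by \<open>f\<close>, then the numbers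
  \<open>eigvec f e N j i\<close> are the coordinates of the eigenvector of \<open>diagm e + N\<close> for the eigenvalue
  \<open>e j\<close>, normalized to have \<open>j\<close>-th coordinate \<open>1\<close>; back substitution makes them polynomials in the
  entries of \<open>N\<close>.\<close>

function eigvec :: "('n::finite \<Rightarrow> int) \<Rightarrow> ('n \<Rightarrow> complex) \<Rightarrow> complex^'n^'n \<Rightarrow> 'n \<Rightarrow> 'n \<Rightarrow> complex" where
  "eigvec f e N j i =
     (if f i < f j then (\<Sum>k | f i < f k \<and> f k \<le> f j. N $ i $ k * eigvec f e N j k) / (e j - e i)
      else if i = j then 1 else 0)"
  by pat_completeness auto
termination
  by (relation "Wellfounded.measure (\<lambda>(f, e, N, j, i). nat (f j - f i))") auto

declare eigvec.simps [simp del]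

definition eigmat :: "('n::finite \<Rightarrow> int) \<Rightarrow> ('n \<Rightarrow> complex) \<Rightarrow> complex^'n^'n \<Rightarrow> complex^'n^'n" where
  "eigmat f e N = (\<chi> i j. eigvec f e N j i)"

definition diagm :: "('n \<Rightarrow> complex) \<Rightarrow> complex^'n^'n" where
  "diagm e = (\<chi> i j. if i = j then e i else 0)"

lemma diagm_mult_left: "(diagm e ** A) $ i $ j = e i * A $ i $ j"
  by (simp add: diagm_def matrix_matrix_mult_def if_distrib[of "\<lambda>x. x * _"] cong: if_cong)

lemma diagm_mult_right: "(A ** diagm e) $ i $ j = A $ i $ j * e j"
  by (simp add: diagm_def matrix_matrix_mult_def if_distrib[of "\<lambda>x. _ * x"] cong: if_cong)

lemma eigvec_diag: "eigvec f e N j j = 1"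
  by (subst eigvec.simps) simp

lemma eigvec_eq_0: "i \<noteq> j \<Longrightarrow> f j \<le> f i \<Longrightarrow> eigvec f e N j i = 0"
  by (subst eigvec.simps) simp

lemma continuous_on_eigvec:
  assumes "continuous_on S N"
  shows "continuous_on S (\<lambda>x. eigvec f e (N x) j i)"
proof (induction "nat (f j - f i)" arbitrary: i rule: less_induct)
  case less
  show ?case
  proof (cases "f i < f j")
    case True
    have "continuous_on S (\<lambda>x. eigvec f e (N x) j k)" if "f i < f k" "f k \<le> f j" for k
      using that by (intro less) auto
    then have "continuous_on S (\<lambda>x. (\<Sum>k | f i < f k \<and> f k \<le> f j. N x $ i $ k * eigvec f e (N x) j k) * inverse (e j - e i))"
      by (intro continuous_intros assms) auto
    then show ?thesis
      by (subst eigvec.simps) (simp add: True divide_inverse)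
  next
    case False
    then show ?thesis
      by (subst eigvec.simps) simp
  qed
qed

lemma continuous_on_eigmat [continuous_intros]:
  "continuous_on S N \<Longrightarrow> continuous_on S (\<lambda>x. eigmat f e (N x))"
  unfolding eigmat_def by (intro continuous_intros continuous_on_eigvec)

lemma matrix_mult_add_rdistrib: "(A + B) ** C = A ** C + B ** (C :: complex^'n::finite^'n)"
  by (simp add: matrix_matrix_mult_def vec_eq_iff sum.distrib algebra_simps)

text \<open>Column by column this is the eigenvector equation, which is the recursion for
  \<open>eigvec\<close> multiplied by \<open>e j - e i\<close>. The remaining terms vanish: those
  with \<open>f k \<le> f i\<close> through \<open>N\<close>, those with \<open>f j < f k\<close>
  through \<open>eigvec\<close>.\<close>

lemma eigmat_right:
  assumes f: "inj f" and e: "inj e"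
    and N: "\<And>i j. \<not> f i < f j \<Longrightarrow> N $ i $ j = 0"
  shows "(diagm e + N) ** eigmat f e N = eigmat f e N ** diagm e"
proof -
  have "e i * eigvec f e N j i + (\<Sum>k\<in>UNIV. N $ i $ k * eigvec f e N j k) = eigvec f e N j i * e j" for i j
  proof -
    have "(\<Sum>k\<in>UNIV. N $ i $ k * eigvec f e N j k) =
        (\<Sum>k | f i < f k \<and> f k \<le> f j. N $ i $ k * eigvec f e N j k)"
    proof (intro sum.mono_neutral_right ballI)
      fix k assume "k \<in> UNIV - {k. f i < f k \<and> f k \<le> f j}"
      then have "\<not> f i < f k \<or> f j < f k" by auto
      then show "N $ i $ k * eigvec f e N j k = 0"
        using N[of i k] eigvec_eq_0[of k j f e N] by fastforce
    qed auto
    moreover have "(\<Sum>k | f i < f k \<and> f k \<le> f j. N $ i $ k * eigvec f e N j k) = (e j - e i) * eigvec f e N j i"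
    proof (cases "f i < f j")
      case True
      then have "i \<noteq> j" by auto
      then have "e j - e i \<noteq> 0"
        using injD[OF e] by auto
      then show ?thesis
        using True by (subst (2) eigvec.simps) simp
    next
      case False
      then have "{k. f i < f k \<and> f k \<le> f j} = {}" by auto
      then have "(\<Sum>k | f i < f k \<and> f k \<le> f j. N $ i $ k * eigvec f e N j k) = 0"
        by (simp only: sum.empty)
      then show ?thesis
        using False eigvec_eq_0[of i j f e N] by (cases "i = j") auto
    qed
    ultimately show ?thesis
      by (simp add: algebra_simps)
  qed
  then show ?thesis
    unfolding vec_eq_iff diagm_mult_right
    by (simp add: matrix_mult_add_rdistrib diagm_mult_left) (simp add: eigmat_def matrix_matrix_mult_def)
qed

text \<open>The rows are the left eigenvectors of \<open>diagm e + N\<close>. Multiplied by \<open>eigmat f e N\<close>, this gives a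
  unitriangular matrix commuting with \<open>diagm e\<close>, hence the identity.\<close>

definition eigmat_inv :: "('n::finite \<Rightarrow> int) \<Rightarrow> ('n \<Rightarrow> complex) \<Rightarrow> complex^'n^'n \<Rightarrow> complex^'n^'n" where
  "eigmat_inv f e N = transpose (eigmat (\<lambda>i. - f i) e (transpose N))"

lemma continuous_on_eigmat_inv [continuous_intros]:
  "continuous_on S N \<Longrightarrow> continuous_on S (\<lambda>x. eigmat_inv f e (N x))"
  unfolding eigmat_inv_def transpose_def by (intro continuous_intros)

text \<open>The transpose of \<open>N\<close> is strictly upper triangular for the reversed order
  \<open>- f\<close>, so this is the right eigenvector equation of the transpose, transposed
  back.\<close>

lemma eigmat_left:
  assumes f: "inj f" and e: "inj e"
    and N: "\<And>i j. \<not> f i < f j \<Longrightarrow> N $ i $ j = 0"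
  shows "eigmat_inv f e N ** (diagm e + N) = diagm e ** eigmat_inv f e N"
proof -
  have "(diagm e + transpose N) ** eigmat (\<lambda>i. - f i) e (transpose N) =
      eigmat (\<lambda>i. - f i) e (transpose N) ** diagm e"
    using f e N by (intro eigmat_right) (auto simp: inj_def transpose_def)
  then have "transpose ((diagm e + transpose N) ** eigmat (\<lambda>i. - f i) e (transpose N)) =
      transpose (eigmat (\<lambda>i. - f i) e (transpose N) ** diagm e)"
    by simp
  moreover have "transpose (diagm e + transpose N) = diagm e + N" "transpose (diagm e) = diagm e"
    by (auto simp: transpose_def diagm_def vec_eq_iff)
  ultimately show ?thesis
    unfolding eigmat_inv_def matrix_transpose_mul by simp
qed


lemma eigmat_inverse:
  assumes f: "inj f" and e: "inj e"
    and N: "\<And>i j. \<not> f i < f j \<Longrightarrow> N $ i $ j = 0"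
  shows "eigmat_inv f e N ** eigmat f e N = mat 1"
proof -
  define G where "G = eigmat f e N"
  define H where "H = eigmat_inv f e N"
  have left: "H ** (diagm e + N) = diagm e ** H"
    unfolding H_def by (rule eigmat_left[OF assms])
  have right: "(diagm e + N) ** G = G ** diagm e"
    unfolding G_def by (rule eigmat_right[OF assms])
  have "diagm e ** (H ** G) = H ** (diagm e + N) ** G"
    by (metis left matrix_mul_assoc)
  also have "\<dots> = (H ** G) ** diagm e"
    by (metis right matrix_mul_assoc)
  finally have comm: "diagm e ** (H ** G) = (H ** G) ** diagm e" .
  \<comment> \<open>Commuting with a diagonal matrix of distinct entries forces the off-diagonal
    entries to vanish.\<close>
  have "(H ** G) $ i $ j = 0" if "i \<noteq> j" for i j
  proof -
    have "e i * (H ** G) $ i $ j = (H ** G) $ i $ j * e j"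
      using comm by (metis diagm_mult_left diagm_mult_right)
    moreover have "e i \<noteq> e j"
      using e that by (auto dest: injD)
    ultimately show ?thesis by simp
  qed
  moreover have "(H ** G) $ i $ i = 1" for i
  proof -
    have "(H ** G) $ i $ i = (\<Sum>k\<in>UNIV. H $ i $ k * G $ k $ i)"
      by (simp add: matrix_matrix_mult_def)
    also have "\<dots> = H $ i $ i * G $ i $ i"
    \<comment> \<open>For \<open>k \<noteq> i\<close> the factor from \<open>H\<close> vanishes when
      \<open>f k \<le> f i\<close>, the one from \<open>G\<close> when
      \<open>f i \<le> f k\<close>.\<close>
    proof (rule sum_UNIV_single)
      fix k assume "k \<noteq> i"
      then show "H $ i $ k * G $ k $ i = 0"
        by (cases "f i \<le> f k")
          (auto simp: H_def G_def eigmat_inv_def eigmat_def transpose_def eigvec_eq_0)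
    qed
    also have "\<dots> = 1"
      by (simp add: H_def G_def eigmat_inv_def eigmat_def transpose_def eigvec_diag)
    finally show ?thesis .
  qed
  ultimately show ?thesis
    unfolding G_def H_def by (simp add: vec_eq_iff mat_def)
qed

text \<open>The conjugating matrices depend continuously on \<open>N\<close>, so a continuous family
  of such triangular matrices is continuously similar to the constant
  \<open>diagm e\<close>.\<close>

lemma triangular_diagonalization:
  assumes f: "inj f" and e: "inj e"
    and N: "\<And>i j. \<not> f i < f j \<Longrightarrow> N $ i $ j = 0"
  shows "diagm e + N = eigmat f e N ** diagm e ** eigmat_inv f e N"
  by (metis eigmat_inverse[OF assms] eigmat_right[OF assms] matrix_left_right_inverse
      matrix_mul_assoc matrix_mul_rid)

section \<open>Polynomials of diagonal and of similar matrices\<close>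

lemma mat_mult_commute: "mat c ** A = A ** mat c" for A :: "complex^'n::finite^'n"
proof -
  have "mat c = (diagm (\<lambda>_. c) :: complex^'n^'n)"
    by (simp add: mat_def diagm_def vec_eq_iff)
  then show ?thesis
    by (metis (no_types, lifting) vec_eq_iff diagm_mult_left diagm_mult_right mult.commute)
qed

lemma matpow_conj:
  fixes G H A :: "complex^'n::finite^'n"
  assumes "H ** G = mat 1"
  shows "matpow (G ** A ** H) k = G ** matpow A k ** H"
proof (induction k)
  case 0
  have "G ** H = mat 1"
    using assms by (rule iffD1[OF matrix_left_right_inverse])
  then show ?case
    by simp
next
  case (Suc k)
  have "(G ** A ** H) ** (G ** matpow A k ** H) = G ** A ** (H ** G) ** matpow A k ** H"
    by (simp add: matrix_mul_assoc)
  then show ?case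
    using Suc assms by (simp add: matrix_mul_assoc)
qed

lemma matrix_mult_sum_conj:
  fixes G H :: "complex^'n::finite^'n"
  shows "finite S \<Longrightarrow> (\<Sum>i\<in>S. G ** F i ** H) = G ** (\<Sum>i\<in>S. F i) ** H"
proof (induction S rule: finite_induct)
  case empty
  then show ?case
    by (simp add: vec_eq_iff matrix_matrix_mult_def)
qed (simp add: matrix_add_ldistrib matrix_mult_add_rdistrib)

lemma mat_poly_conj:
  fixes G H A :: "complex^'n::finite^'n"
  assumes "H ** G = mat 1"
  shows "mat_poly p (G ** A ** H) = G ** mat_poly p A ** H"
proof -
  have *: "mat c ** (G ** M ** H) = G ** (mat c ** M) ** H" for c M
    by (metis mat_mult_commute matrix_mul_assoc)
  then show ?thesis
    unfolding mat_poly_def matpow_conj[OF assms] * by (intro matrix_mult_sum_conj) simp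
qed

lemma mat_poly_diagm: "mat_poly p (diagm l) = diagm (\<lambda>i. poly p (l i))"
proof -
  have pow: "matpow (diagm l) k = diagm (\<lambda>i. l i ^ k)" for k
  proof (induction k)
    case 0
    then show ?case by (simp add: mat_def diagm_def vec_eq_iff)
  next
    case (Suc k)
    then show ?case by (simp add: vec_eq_iff diagm_mult_left) (simp add: diagm_def)
  qed
  have "mat c ** diagm h = diagm (\<lambda>i. c * h i)" for c and h :: "'a \<Rightarrow> complex"
    by (simp add: vec_eq_iff mat_mult_commute diagm_mult_right mat_def) (simp add: diagm_def mat_def)
  then show ?thesis
    unfolding mat_poly_def pow by (simp add: vec_eq_iff) (simp add: diagm_def poly_altdef)
qed

subsection \<open>Polynomial commutators\<close>

lemma continuous_unitary_constant_diagonal: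
  fixes c :: "'x::t2_space \<Rightarrow> complex^'n::finite^'n"
  assumes "compact (UNIV :: 'x set)" "extremally_disconnected TYPE('x)"
    and c: "continuous_on UNIV c"
  obtains U where "continuous_on UNIV U" "\<And>x. U x \<in> unitaries"
    "\<And>x i k. (cadj (U x) ** c x ** U x) $ i $ i = (cadj (U x) ** c x ** U x) $ k $ k"
proof -
  \<comment> \<open>The admissible pairs of a point and a unitary form a closed subset of a compact
    product, and pointwise existence makes it project onto the base; the section theorem then
    applies.\<close>
  define K where "K = (UNIV \<times> unitaries) \<inter>
    {z :: 'x \<times> (complex^'n^'n). \<forall>i k. (cadj (snd z) ** c (fst z) ** snd z) $ i $ i
      = (cadj (snd z) ** c (fst z) ** snd z) $ k $ k}"
  have "continuous_on UNIV (\<lambda>z :: 'x \<times> (complex^'n^'n). c (fst z))"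
    by (rule continuous_on_compose2[OF c]) (auto intro: continuous_intros)
  then have "closed {z :: 'x \<times> (complex^'n^'n). \<forall>i k. (cadj (snd z) ** c (fst z) ** snd z) $ i $ i
      = (cadj (snd z) ** c (fst z) ** snd z) $ k $ k}"
    by (intro closed_Collect_all closed_Collect_eq continuous_intros)
  moreover have "compact ((UNIV :: 'x set) \<times> (unitaries :: (complex^'n^'n) set))"
    using assms(1) compact_unitaries by (rule compact_Times)
  ultimately have "compact K"
    unfolding K_def by (rule compact_Int_closed[rotated])
  moreover have "x \<in> fst ` K" for x
  proof -
    obtain U where "(x, U) \<in> K"
      using exists_unitary_constant_diagonal[of "c x"] by (auto simp: K_def)
    then show ?thesis
      by (rule image_eqI[rotated]) simp
  qed
  ultimately obtain s where "continuous_on UNIV s" and s: "\<And>x. (x, s x) \<in> K"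
    using continuous_section_of_compact_relation[OF assms(2), of K] by blast
  then show thesis
    by (intro that[of s]) (auto simp: K_def)
qed

lemma MnCX_iff_continuous: "A \<in> MnCX \<longleftrightarrow> continuous_on UNIV A"
proof
  assume "A \<in> MnCX"
  then have "continuous_on UNIV (\<lambda>x. \<chi> i j. A x $ i $ j)"
    by (intro continuous_on_vec_lambda) (simp add: MnCX_def)
  moreover have "(\<lambda>x. \<chi> i j. A x $ i $ j) = A"
    by (simp add: vec_eq_iff fun_eq_iff)
  ultimately show "continuous_on UNIV A"
    by simp
qed (auto simp: MnCX_def intro: continuous_intros)

lemma poly_commutatorsI:
  assumes "continuous_on UNIV a" "continuous_on UNIV b"
    and "\<And>x. v x = mat_poly p (a x ** b x) - mat_poly p (b x ** a x)"
  shows "v \<in> poly_commutators p"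
  unfolding poly_commutators_def
  by (intro CollectI exI[of _ a] exI[of _ b])
    (simp add: MnCX_iff_continuous MnCX_poly_def MnCX_mult_def fun_eq_iff assms)

lemma unitariesD:
  assumes "U \<in> unitaries"
  shows "cadj U ** U = mat 1" "U ** cadj U = mat 1"
  using assms matrix_left_right_inverse[of U "cadj U"] by (auto simp: unitaries_def)

lemma poly_surj:
  fixes p :: "complex poly"
  assumes "degree p \<ge> 1"
  shows "\<exists>z. poly p z = w"
proof -
  have "degree (p + - [:w:]) = degree p"
    using assms by (intro degree_add_eq_left) simp
  then have "\<not> constant (poly (p + - [:w:]))"
    using assms by (simp add: constant_degree)
  then show ?thesis
    using fundamental_theorem_of_algebra by fastforce
qed

lemma zero_diagonal_is_poly_commutator:
  fixes d :: "'x::topological_space \<Rightarrow> complex^'n::finite^'n"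
  assumes p: "degree p \<ge> 1" and d: "continuous_on UNIV d" and zero: "\<And>x i. d x $ i $ i = 0"
  shows "\<exists>a b. continuous_on UNIV a \<and> continuous_on UNIV b \<and>
    (\<forall>x. d x = mat_poly p (a x ** b x) - mat_poly p (b x ** a x))"
proof -
  \<comment> \<open>One numbering of the indices serves twice: as the order \<open>f\<close>
    defining triangularity and as the distinct eigenvalues \<open>e\<close>.\<close>
  obtain f0 :: "'n \<Rightarrow> nat" where f0: "inj f0"
    using finite_imp_inj_to_nat_seg[of "UNIV :: 'n set"] by blast
  define f where "f i = int (f0 i)" for i
  define e where "e i = complex_of_nat (f0 i)" for i
  have f: "inj f" and f': "inj (\<lambda>i. - f i)" and e: "inj e"
    using f0 by (auto simp: f_def e_def inj_def)
  \<comment> \<open>Preimages under \<open>p\<close>, so that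
    \<open>mat_poly p (diagm l) = diagm e\<close>.\<close>
  define l where "l i = (SOME z. poly p z = e i)" for i
  have l: "poly p (l i) = e i" for i
    unfolding l_def by (rule someI_ex) (rule poly_surj[OF p])
  define Up where "Up x = (\<chi> i j. if f i < f j then d x $ i $ j else 0)" for x
  \<comment> \<open>The sign makes \<open>d x = Up x - Lo x\<close>. For the order
    \<open>- f\<close> this part is strictly upper triangular, so the same diagonalization
    applies.\<close>
  define Lo where "Lo x = (\<chi> i j. if f j < f i then - d x $ i $ j else 0)" for x
  have Up: "Up x $ i $ j = 0" if "\<not> f i < f j" for x i j
    using that by (simp add: Up_def)
  have Lo: "Lo x $ i $ j = 0" if "\<not> - f i < - f j" for x i j
    using that by (simp add: Lo_def)
  have "continuous_on UNIV (\<lambda>x. if f i < f j then d x $ i $ j else 0)" for i j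
    using d by (cases "f i < f j") (auto intro!: continuous_intros)
  then have cUp: "continuous_on UNIV Up"
    unfolding Up_def by (intro continuous_intros)
  have "continuous_on UNIV (\<lambda>x. if f j < f i then - d x $ i $ j else 0)" for i j
    using d by (cases "f j < f i") (auto intro!: continuous_intros)
  then have cLo: "continuous_on UNIV Lo"
    unfolding Lo_def by (intro continuous_intros)
  have d_eq: "d x = (diagm e + Up x) - (diagm e + Lo x)" for x
  proof -
    have "d x $ i $ j = Up x $ i $ j - Lo x $ i $ j" for i j
      using injD[OF f, of i j]
      by (cases "f i" "f j" rule: linorder_cases) (auto simp: Up_def Lo_def zero)
    then show ?thesis
      by (simp add: vec_eq_iff)
  qed
  define G where "G x = eigmat f e (Up x)" for x
  define H where "H x = eigmat_inv f e (Up x)" for x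
  define G' where "G' x = eigmat (\<lambda>i. - f i) e (Lo x)" for x
  define H' where "H' x = eigmat_inv (\<lambda>i. - f i) e (Lo x)" for x
  have HG: "H x ** G x = mat 1" and P: "diagm e + Up x = G x ** diagm e ** H x" for x
    unfolding H_def G_def
    using eigmat_inverse[OF f e Up] triangular_diagonalization[OF f e Up] by blast+
  have HG': "H' x ** G' x = mat 1" and Q: "diagm e + Lo x = G' x ** diagm e ** H' x" for x
    unfolding H'_def G'_def
    using eigmat_inverse[OF f' e Lo] triangular_diagonalization[OF f' e Lo] by blast+
  \<comment> \<open>The inner factors cancel in both products: \<open>a x ** b x\<close> and
    \<open>b x ** a x\<close> become conjugates of \<open>diagm l\<close>, by \<open>G x\<close> and
    by \<open>G' x\<close> respectively.\<close>
  define a where "a x = G x ** diagm l ** H' x" for x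
  define b where "b x = G' x ** H x" for x
  have ab: "a x ** b x = G x ** diagm l ** H x" for x
    unfolding a_def b_def by (metis HG' matrix_mul_assoc matrix_mul_rid)
  have ba: "b x ** a x = G' x ** diagm l ** H' x" for x
    unfolding a_def b_def by (metis HG matrix_mul_assoc matrix_mul_rid)
  have "mat_poly p (a x ** b x) = diagm e + Up x" for x
    unfolding ab mat_poly_conj[OF HG] mat_poly_diagm l P ..
  moreover have "mat_poly p (b x ** a x) = diagm e + Lo x" for x
    unfolding ba mat_poly_conj[OF HG'] mat_poly_diagm l Q ..
  moreover have "continuous_on UNIV a" "continuous_on UNIV b"
    unfolding a_def b_def G_def H_def G'_def H'_def
    by (intro continuous_intros cUp cLo)+
  ultimately show ?thesis
    using d_eq by metis
qed

lemma trace_cadj_conj: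
  assumes "U \<in> unitaries"
  shows "trace (cadj U ** v ** U) = trace v"
  by (metis assms matrix_mul_assoc matrix_mul_lid trace_mul_sym unitariesD(2))

lemma trace_zero_is_poly_commutator:
  fixes v :: "'x::t2_space \<Rightarrow> complex^'n::finite^'n"
  assumes X: "compact (UNIV :: 'x set)" "extremally_disconnected TYPE('x)"
    and p: "degree p \<ge> 1" and v: "continuous_on UNIV v" and tr: "\<And>x. trace (v x) = 0"
  shows "v \<in> poly_commutators p"
proof -
  obtain U where cU: "continuous_on UNIV U" and U: "\<And>x. U x \<in> unitaries"
    and diag: "\<And>x i k. (cadj (U x) ** v x ** U x) $ i $ i = (cadj (U x) ** v x ** U x) $ k $ k"
    using continuous_unitary_constant_diagonal[OF X v] by blast
  define d where "d x = cadj (U x) ** v x ** U x" for x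
  have "d x $ i $ i = 0" for x i
  proof -
    \<comment> \<open>The diagonal is constant, so \<open>CARD('n)\<close> times one entry is the
      trace, which is zero.\<close>
    have "(\<Sum>k\<in>(UNIV :: 'n set). d x $ i $ i) = (\<Sum>k\<in>UNIV. d x $ k $ k)"
      unfolding d_def by (intro sum.cong refl diag)
    also have "\<dots> = 0"
      using trace_cadj_conj[OF U] tr by (simp add: d_def trace_def)
    finally show ?thesis by simp
  qed
  moreover have "continuous_on UNIV d"
    unfolding d_def by (intro continuous_intros cU v)
  ultimately obtain a b where cab: "continuous_on UNIV a" "continuous_on UNIV b"
    and d: "\<And>x. d x = mat_poly p (a x ** b x) - mat_poly p (b x ** a x)"
    using zero_diagonal_is_poly_commutator[OF p] by metis
  \<comment> \<open>Products and \<open>mat_poly\<close> are compatible with conjugation by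
    \<open>U x\<close>, so conjugating \<open>a\<close> and \<open>b\<close> back turns the
    representation of \<open>d\<close> into one of \<open>v\<close>.\<close>
  define a' where "a' x = U x ** a x ** cadj (U x)" for x
  define b' where "b' x = U x ** b x ** cadj (U x)" for x
  have conj_mult: "(U x ** A ** cadj (U x)) ** (U x ** B ** cadj (U x)) = U x ** (A ** B) ** cadj (U x)" for x A B
    by (metis unitariesD(1)[OF U] matrix_mul_assoc matrix_mul_rid)
  have conj_diff: "U x ** (A - B) ** cadj (U x) = U x ** A ** cadj (U x) - U x ** B ** cadj (U x)" for x A B
    by (simp add: vec_eq_iff matrix_matrix_mult_def sum_subtractf algebra_simps)
  have "v x = U x ** d x ** cadj (U x)" for x
    unfolding d_def by (metis unitariesD(2)[OF U] matrix_mul_assoc matrix_mul_lid matrix_mul_rid)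
  then have "v x = mat_poly p (a' x ** b' x) - mat_poly p (b' x ** a' x)" for x
    unfolding a'_def b'_def conj_mult mat_poly_conj[OF unitariesD(1)[OF U]] conj_diff[symmetric] d .
  moreover have "continuous_on UNIV a'" "continuous_on UNIV b'"
    unfolding a'_def b'_def by (intro continuous_intros cU cab)+
  ultimately show ?thesis
    by (intro poly_commutatorsI)
qed

theorem theorem4p7:
  fixes p :: "complex poly"
  assumes "compact (UNIV :: 'x::t2_space set)"
    and "extremally_disconnected TYPE('x)"
    and "CARD('n::finite) \<ge> 3"
    and "degree p \<ge> 1"
  shows "\<forall>c \<in> (MnCX :: ('x \<Rightarrow> complex^'n^'n) set).
           \<exists>u \<in> poly_commutators p. \<exists>v \<in> poly_commutators p. c = MnCX_mult u v"
proof
  fix c :: "'x \<Rightarrow> complex^'n^'n"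
  assume "c \<in> MnCX"
  then have c: "continuous_on UNIV c"
    by (simp add: MnCX_iff_continuous)
  obtain U where cU: "continuous_on UNIV U" and U: "\<And>x. U x \<in> unitaries"
    and diag: "\<And>x i k. (cadj (U x) ** c x ** U x) $ i $ i = (cadj (U x) ** c x ** U x) $ k $ k"
    using continuous_unitary_constant_diagonal[OF assms(1,2) c] by blast
  \<comment> \<open>The roots of unity, one for each index, sum to zero and have modulus 1, so
    \<open>diagm w\<close> is invertible and both it and its inverse have trace zero.\<close>
  let ?R = "{z :: complex. z ^ CARD('n) = 1}"
  have "card ?R = CARD('n)"
    using assms(3) by (intro card_roots_unity_eq) simp
  moreover from this have "finite ?R"
    using assms(3) by (intro card_ge_0_finite) simp
  ultimately obtain w :: "'n \<Rightarrow> complex" where w: "bij_betw w UNIV ?R"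
    using finite_same_card_bij[of "UNIV :: 'n set" ?R] by auto
  have sum_w: "(\<Sum>i\<in>UNIV. w i) = 0"
    using sum.reindex_bij_betw[OF w, of "\<lambda>z. z"] sum_roots_unity[of "CARD('n)"] assms(3) by simp
  have norm_w: "norm (w i) = 1" for i
    using bij_betwE[OF w] power_eq_1_iff[of "w i" "CARD('n)"] by auto
  have inv: "diagm (\<lambda>i. cnj (w i)) ** diagm w = mat 1"
    using norm_w by (simp add: vec_eq_iff diagm_mult_left)
      (simp add: diagm_def mat_def mult.commute flip: complex_norm_square)
  define u where "u x = U x ** diagm (\<lambda>i. cnj (w i)) ** cadj (U x)" for x
  define v where "v x = U x ** (diagm w ** (cadj (U x) ** c x ** U x)) ** cadj (U x)" for x
  have tr: "trace (U x ** A ** cadj (U x)) = trace A" for x A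
    by (metis U matrix_mul_assoc matrix_mul_lid trace_mul_sym unitariesD(1))
  have "trace (diagm (\<lambda>i. cnj (w i))) = cnj (\<Sum>i\<in>UNIV. w i)"
    by (simp add: trace_def diagm_def)
  then have "u \<in> poly_commutators p"
    by (intro trace_zero_is_poly_commutator[OF assms(1,2,4)])
      (auto simp: u_def tr sum_w intro!: continuous_intros cU)
  \<comment> \<open>The second factor has constant diagonal, so the trace is that constant times the
    sum of the roots of unity.\<close>
  moreover have "trace (diagm w ** (cadj (U x) ** c x ** U x)) = 0" for x
  proof -
    fix k :: 'n
    have "trace (diagm w ** (cadj (U x) ** c x ** U x)) =
        (\<Sum>i\<in>UNIV. w i * (cadj (U x) ** c x ** U x) $ k $ k)"
      unfolding trace_def diagm_mult_left by (intro sum.cong refl arg_cong2[of _ _ _ _ "(*)"] diag)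
    then show ?thesis
      by (simp add: sum_w flip: sum_distrib_right)
  qed
  then have "v \<in> poly_commutators p"
    by (intro trace_zero_is_poly_commutator[OF assms(1,2,4)])
      (auto simp: v_def tr intro!: continuous_intros cU c)
  moreover have "c x = u x ** v x" for x
  proof -
    have "u x ** v x = U x ** (diagm (\<lambda>i. cnj (w i)) ** (cadj (U x) ** U x) ** diagm w) **
        cadj (U x) ** c x ** (U x ** cadj (U x))"
      unfolding u_def v_def by (simp only: matrix_mul_assoc)
    also have "\<dots> = c x"
      by (simp add: unitariesD[OF U] inv)
    finally show ?thesis ..
  qed
  ultimately show "\<exists>u \<in> poly_commutators p. \<exists>v \<in> poly_commutators p. c = MnCX_mult u v"
    by (auto simp: MnCX_mult_def fun_eq_iff)
qed

end
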